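(* Let $\ell\geq 1$ be an integer, let $\{\pi_1,\pi_2,\dots,\pi_\ell\}$ be a partition of $\mathbb{N}$, and let $\sigma_1,\sigma_2,\dots,\sigma_\ell\in\mathbb{R}$. If $\psi:\mathbb{N}\to\mathbb{R}_{\geq 0}$ is decreasing and $\sum_{q=1}^\infty\psi(q)=\infty$, then there exists $k\in\{1,\dots,\ell\}$ such that $\mathrm{m}(W(\mathbf{1}_{\pi_k}\psi,\sigma_k))=1$.
   Context: $\mathbb{N}=\{1,2,3,\dots\}$. "Decreasing" means $\psi(q+1)\leq\psi(q)$ for all $q$. $\|x\|$ denotes the distance from $x\in\mathbb{R}$ to the nearest integer, $\mathrm{m}$ is Lebesgue measure, and $\mathbf{1}_{\pi}$ is the indicator function of $\pi\subset\mathbb{N}$ (so $\mathbf{1}_\pi\psi$ is the pointwise product). For $\psi:\mathbb{N}\to\mathbb{R}_{\geq 0}$ (not necessarily monotone) and a real number $\sigma$, $$W(\psi,\sigma)=\{\alpha\in[0,1] : \|q\alpha-\sigma\|<\psi(q)\text{ for infinitely many } q\in\mathbb{N}\}.$$ *)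

theory Defs
  imports "HOL-Analysis.Analysis"
begin

text \<open>
  The positive integers are the set \<open>{1..}\<close> of type \<open>nat set\<close>; the value at \<open>0\<close>
  of a function on the natural numbers is never used.
\<close>

text \<open>The choice made by \<open>round\<close> at half-integers does not affect the distance.\<close>

definition nearest_int_dist :: "real \<Rightarrow> real" where
  "nearest_int_dist x = \<bar>x - of_int (round x)\<bar>"

definition W :: "(nat \<Rightarrow> real) \<Rightarrow> real \<Rightarrow> real set" where
  "W \<psi> \<sigma> = {\<alpha> \<in> {0..1}. infinite {q \<in> {1..}. nearest_int_dist (real q * \<alpha> - \<sigma>) < \<psi> q}}"

end

theory Submission
  imports Defs "HOL-Real_Asymp.Real_Asymp"
begin

text \<open>
  Cut the denominators into dyadic blocks. By pigeonhole there is one \<open>k\<close> such that \<open>\<pi> k\<close> occupies a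
  proportion at least \<open>1 / l\<close> of each of a set of blocks over which the dyadic form of \<open>\<Sum>\<psi>\<close> still
  diverges, so it suffices to treat one target \<open>\<sigma>\<close> and positive proportions of dyadic blocks.

  The fractions \<open>(a + \<sigma>) / q\<close> with \<open>Q \<le> q < 2 Q\<close> may cluster, which ruins the second moment method
  when applied to the sets \<open>\<parallel>q \<alpha> - \<sigma>\<parallel> < \<psi> q\<close> directly. But more than \<open>M\<close> of them in an interval of
  length \<open>1 / (8 Q\<^sup>2)\<close> force a short primitive vector \<open>(u, w)\<close>, \<open>u \<le> Q / M\<close>, with
  \<open>\<bar>q w - a u - \<sigma> u\<bar> < 1/2\<close>, and the fractions for which there is such a vector are only a
  proportion \<open>O(1 / M)\<close> of all. With \<open>M = 4 l\<close>, deleting them leaves a positive proportion of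
  fractions that are well separated up to bounded multiplicity. Balls around these are
  quasi-independent between blocks, so the Chung--Erdos inequality shows that the balls from late
  blocks fill a fixed proportion of every interval, and the Vitali covering theorem upgrades this
  to full measure.
\<close>

section \<open>Measure theory: a density criterion and a second moment inequality\<close>

text \<open>A weak form of the Lebesgue density theorem. Disjoint Vitali balls inside an open
  \<open>V\<close> of measure below \<open>(2 - c) * \<mu>\<close> cover almost all of
  \<open>S\<close>, so summing the local bounds gives
  \<open>\<mu> \<le> c * (2 - c) * \<mu>\<close>, that is
  \<open>\<mu> * (1 - c)\<^sup>2 \<le> 0\<close>.\<close>

lemma negligible_if_uniformly_not_dense:
  fixes S :: "'a::euclidean_space set"
  assumes S: "S \<in> lmeasurable" and c: "0 \<le> c" "c < 1"
    and dens: "\<And>x r. x \<in> S \<Longrightarrow> 0 < r \<Longrightarrow> r < 1 \<Longrightarrow>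
      emeasure lebesgue (S \<inter> ball x r) \<le> ennreal c * emeasure lebesgue (ball x r)"
  shows "negligible S"
proof (rule ccontr)
  assume "\<not> negligible S"
  define \<mu> where "\<mu> = measure lebesgue S"
  have eS: "emeasure lebesgue S = ennreal \<mu>"
    using S by (simp add: \<mu>_def emeasure_eq_measure2)
  have \<mu>: "\<mu> > 0"
    using \<open>\<not> negligible S\<close> S unfolding \<mu>_def
    by (metis negligible_iff_measure0 measure_nonneg order_le_less)
  have "(1 - c) * \<mu> > 0" using \<mu> c by simp
  then obtain V where V: "open V" "S \<subseteq> V" "V - S \<in> lmeasurable"
      "emeasure lebesgue (V - S) < ennreal ((1 - c) * \<mu>)"
    using sets_lebesgue_outer_open S by (metis fmeasurableD)
  let ?K = "{(x,r). x \<in> S \<and> 0 < r \<and> r < 1 \<and> ball x r \<subseteq> V}"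
  obtain C where C: "countable C" "C \<subseteq> ?K"
     "pairwise (\<lambda>i j. disjnt (ball (fst i) (snd i)) (ball (fst j) (snd j))) C"
     "negligible (S - (\<Union>i\<in>C. ball (fst i) (snd i)))"
  proof (rule Vitali_covering_theorem_balls [of S ?K fst snd])
    fix x and d :: real
    assume x: "x \<in> S" and d: "0 < d"
    obtain k where k: "k > 0" "ball x k \<subseteq> V"
      using V x by (meson openE subsetD)
    let ?r = "min (min (d/2) k) (1/2)"
    have "?r > 0" "?r < d" "?r < 1" "ball x ?r \<subseteq> V"
      using d k by (auto simp: min_def)
    then show "\<exists>i. i \<in> ?K \<and> x \<in> ball (fst i) (snd i) \<and> snd i < d"
      using x by (intro exI [of _ "(x, ?r)"]) auto
  qed blast
  let ?B = "\<lambda>i. ball (fst i) (snd i)"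
  have disj: "disjoint_family_on ?B C"
    using C(3) by (auto simp: disjoint_family_on_def pairwise_def disjnt_def)
  then have disj': "disjoint_family_on (\<lambda>i. S \<inter> ?B i) C"
    unfolding disjoint_family_on_def by blast
  have "emeasure lebesgue S = emeasure lebesgue (\<Union>i\<in>C. S \<inter> ?B i)"
  proof (rule emeasure_eq_AE)
    have "AE x in lebesgue. x \<notin> S - (\<Union>i\<in>C. ?B i)"
      using C(4) unfolding negligible_iff_null_sets by (rule AE_not_in)
    then show "AE x in lebesgue. (x \<in> S) = (x \<in> (\<Union>i\<in>C. S \<inter> ?B i))"
      by eventually_elim auto
    show "S \<in> sets lebesgue" using S by auto
    show "(\<Union>i\<in>C. S \<inter> ?B i) \<in> sets lebesgue"
      using S C(1) by (intro sets.countable_UN' sets.Int) (auto simp: fmeasurableD)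
  qed
  also have "\<dots> = (\<integral>\<^sup>+i. emeasure lebesgue (S \<inter> ?B i) \<partial>count_space C)"
    using S by (intro emeasure_UN_countable disj' C sets.Int) (auto simp: fmeasurableD)
  also have "\<dots> \<le> (\<integral>\<^sup>+i. ennreal c * emeasure lebesgue (?B i) \<partial>count_space C)"
    using C(2) by (intro nn_integral_mono dens) auto
  also have "\<dots> = ennreal c * (\<integral>\<^sup>+i. emeasure lebesgue (?B i) \<partial>count_space C)"
    by (intro nn_integral_cmult) auto
  also have "(\<integral>\<^sup>+i. emeasure lebesgue (?B i) \<partial>count_space C) = emeasure lebesgue (\<Union>i\<in>C. ?B i)"
    by (intro emeasure_UN_countable [symmetric] disj C) auto
  also have "\<dots> \<le> emeasure lebesgue V"
  proof (rule emeasure_mono)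
    show "(\<Union>i\<in>C. ?B i) \<subseteq> V" using C(2) by (fastforce simp del: mem_ball)
    show "V \<in> sets lebesgue" using V(1) by (simp add: borel_open)
  qed
  also have "emeasure lebesgue V \<le> emeasure lebesgue S + emeasure lebesgue (V - S)"
    using emeasure_subadditive [of S lebesgue "V - S"] V S
    by (simp add: Un_absorb1 fmeasurableD)
  also have "\<dots> \<le> ennreal \<mu> + ennreal ((1 - c) * \<mu>)"
    using V(4) eS by (intro add_mono) auto
  finally have "ennreal \<mu> \<le> ennreal c * (ennreal \<mu> + ennreal ((1 - c) * \<mu>))"
    using eS by (simp add: mult_left_mono)
  also have "\<dots> = ennreal (c * (\<mu> + (1 - c) * \<mu>))"
    using c \<mu> by (simp add: ennreal_mult)
  finally have "\<mu> \<le> c * (\<mu> + (1 - c) * \<mu>)"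
    using c \<mu> by (subst (asm) ennreal_le_iff) auto
  then have "\<mu> * (1 - c)\<^sup>2 \<le> 0" by (simp add: algebra_simps power2_eq_square)
  moreover have "\<mu> * (1 - c)\<^sup>2 > 0" using \<mu> c by simp
  ultimately show False by linarith
qed

text \<open>Let \<open>f\<close> count the sets containing a point. On the union,
  \<open>2 * t * f \<le> t\<^sup>2 + f\<^sup>2\<close>, and off it \<open>f = 0\<close>. Integrating
  this and optimising in \<open>t\<close> takes the place of the Cauchy-Schwarz inequality.\<close>

lemma chung_erdos:
  assumes X: "finite X" and B: "\<And>i. i \<in> X \<Longrightarrow> B i \<in> fmeasurable M"
  shows "(\<Sum>i\<in>X. measure M (B i))\<^sup>2
    \<le> measure M (\<Union>i\<in>X. B i) * (\<Sum>i\<in>X. \<Sum>j\<in>X. measure M (B i \<inter> B j))"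
proof -
  define a m S where "a = (\<Sum>i\<in>X. measure M (B i))" and "m = measure M (\<Union>i\<in>X. B i)"
    and "S = (\<Sum>i\<in>X. \<Sum>j\<in>X. measure M (B i \<inter> B j))"
  have U: "(\<Union>i\<in>X. B i) \<in> fmeasurable M"
    using X B by (intro fmeasurable.finite_UN) auto
  have key: "2 * t * a \<le> t\<^sup>2 * m + S" for t :: real
  proof -
    let ?f = "\<lambda>x. \<Sum>i\<in>X. indicator (B i) x :: real"
    have intB: "integrable M (indicator D :: _ \<Rightarrow> real)" if "D \<in> fmeasurable M" for D
      using that by (simp add: fmeasurable_def)
    have BB: "B i \<inter> B j \<in> fmeasurable M" if "i \<in> X" "j \<in> X" for i j
      using B that by (intro fmeasurable_Int_fmeasurable) (auto simp: fmeasurableD)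
    have pointwise: "2 * t * ?f x \<le> t\<^sup>2 * indicator (\<Union>i\<in>X. B i) x
          + (\<Sum>i\<in>X. \<Sum>j\<in>X. indicator (B i \<inter> B j) x)" for x
    proof -
      have sq: "(\<Sum>i\<in>X. \<Sum>j\<in>X. indicator (B i \<inter> B j) x) = (?f x)\<^sup>2"
        by (simp add: power2_eq_square sum_product indicator_inter_arith)
      show ?thesis
      proof (cases "x \<in> (\<Union>i\<in>X. B i)")
        case True
        have "0 \<le> (t - ?f x)\<^sup>2" by simp
        then show ?thesis using True unfolding sq by (simp add: power2_eq_square algebra_simps)
      next
        case False
        then have "?f x = 0" by (intro sum.neutral) (auto simp: indicator_def)
        then show ?thesis by (simp add: sum_nonneg)
      qed
    qed
    have "2 * t * a = (\<integral>x. 2 * t * ?f x \<partial>M)"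
      unfolding a_def using B intB by (simp add: Int_absorb1 fmeasurableD sets.sets_into_space)
    also have "\<dots> \<le> (\<integral>x. t\<^sup>2 * indicator (\<Union>i\<in>X. B i) x
          + (\<Sum>i\<in>X. \<Sum>j\<in>X. indicator (B i \<inter> B j) x) \<partial>M)"
      by (intro integral_mono pointwise Bochner_Integration.integrable_add integrable_mult_right
          Bochner_Integration.integrable_sum intB U B BB)
    also have "\<dots> = (\<integral>x. t\<^sup>2 * indicator (\<Union>i\<in>X. B i) x \<partial>M)
          + (\<integral>x. (\<Sum>i\<in>X. \<Sum>j\<in>X. indicator (B i \<inter> B j) x) \<partial>M)"
      by (intro Bochner_Integration.integral_add integrable_mult_right
          Bochner_Integration.integrable_sum intB U BB)
    also have "(\<integral>x. t\<^sup>2 * indicator (\<Union>i\<in>X. B i) x \<partial>M) = t\<^sup>2 * m"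
      using U unfolding m_def by (simp add: Int_absorb2 fmeasurableD sets.sets_into_space)
    also have "(\<integral>x. (\<Sum>i\<in>X. \<Sum>j\<in>X. indicator (B i \<inter> B j) x) \<partial>M) = S"
    proof -
      have "(\<integral>x. indicator (B i \<inter> B j) x \<partial>M) = measure M (B i \<inter> B j)" if "i \<in> X" "j \<in> X" for i j
        using BB [OF that] by (simp add: Int_absorb2 fmeasurableD sets.sets_into_space)
      then show ?thesis
        unfolding S_def
        by (simp add: Bochner_Integration.integral_sum Bochner_Integration.integrable_sum intB BB)
    qed
    finally show ?thesis .
  qed
  have m0: "m \<ge> 0" by (simp add: m_def)
  show ?thesis
  proof (cases "m = 0")
    case True
    have "measure M (B i) \<le> m" if "i \<in> X" for i
      unfolding m_def using that B U by (intro measure_mono_fmeasurable) (auto simp: fmeasurableD)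
    then have "measure M (B i) = 0" if "i \<in> X" for i
      using that True by (metis measure_nonneg order_antisym)
    then show ?thesis by (simp add: sum_nonneg)
  next
    case False
    then have "m > 0" using m0 by simp
    \<comment> \<open>The quadratic \<open>t\<^sup>2 * m - 2 * t * a + S\<close> is minimal at
      \<open>t = a / m\<close>.\<close>
    with key [of "a / m"] have "a\<^sup>2 \<le> m * S"
      by (simp add: field_simps power2_eq_square)
    then show ?thesis by (simp add: a_def m_def S_def)
  qed
qed

section \<open>Counting shifted fractions in an interval\<close>

text \<open>The condition \<open>x \<le> y + 1\<close> keeps the upper bound non-negative when the
  interval is empty.\<close>

lemma
  fixes x y :: real
  shows finite_int_between: "finite {a::int. x \<le> of_int a \<and> of_int a \<le> y}"
    and card_int_between_le: "x \<le> y + 1 \<Longrightarrow> real (card {a::int. x \<le> of_int a \<and> of_int a \<le> y}) \<le> y - x + 1"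
    and card_int_between_ge: "y - x - 1 \<le> real (card {a::int. x \<le> of_int a \<and> of_int a \<le> y})"
proof -
  have eq: "{a::int. x \<le> of_int a \<and> of_int a \<le> y} = {\<lceil>x\<rceil>..\<lfloor>y\<rfloor>}"
    by (auto simp: le_floor_iff ceiling_le_iff)
  show "finite {a::int. x \<le> of_int a \<and> of_int a \<le> y}" by (simp add: eq)
  show "real (card {a::int. x \<le> of_int a \<and> of_int a \<le> y}) \<le> y - x + 1" if "x \<le> y + 1"
    unfolding eq using that by simp linarith
  show "y - x - 1 \<le> real (card {a::int. x \<le> of_int a \<and> of_int a \<le> y})"
    unfolding eq by simp linarith
qed

definition shifted_frac :: "real \<Rightarrow> nat \<times> int \<Rightarrow> real" where
  "shifted_frac \<sigma> p = (of_int (snd p) + \<sigma>) / real (fst p)"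

text \<open>Pairs are collected instead of real values, so coinciding fractions are counted with
  multiplicity.\<close>

definition shifted_fracs :: "real \<Rightarrow> nat set \<Rightarrow> real \<Rightarrow> real \<Rightarrow> (nat \<times> int) set" where
  "shifted_fracs \<sigma> A z h = {p. fst p \<in> A \<and> \<bar>shifted_frac \<sigma> p - z\<bar> \<le> h}"

text \<open>
  The point \<open>(q, a)\<close> lies close to the line through \<open>(0, -\<sigma>)\<close> with direction \<open>(u, w)\<close>; as \<open>u \<le> Q / M\<close>
  is short, that line may carry more than \<open>M\<close> points \<open>(r, b)\<close> with almost the same \<open>(b + \<sigma>) / r\<close>.
\<close>

definition resonant :: "real \<Rightarrow> nat \<Rightarrow> nat \<Rightarrow> nat \<times> int \<Rightarrow> bool" where
  "resonant \<sigma> M Q p \<longleftrightarrow> (\<exists>u w. 1 \<le> u \<and> u * M \<le> Q \<and> coprime (int u) w \<and>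
     \<bar>real (fst p) * of_int w - of_int (snd p) * real u - \<sigma> * real u\<bar> < 1/2)"

lemma shifted_fracs_eq_Sigma:
  assumes "0 \<notin> A"
  shows "shifted_fracs \<sigma> A z h = (SIGMA q:A. {a::int.
     real q * (z - h) - \<sigma> \<le> of_int a \<and> of_int a \<le> real q * (z + h) - \<sigma>})"
proof -
  have "(\<bar>(of_int a + \<sigma>) / real q - z\<bar> \<le> h) \<longleftrightarrow>
     (real q * (z - h) - \<sigma> \<le> of_int a \<and> of_int a \<le> real q * (z + h) - \<sigma>)" if "q \<in> A" for q a
  proof -
    have "real q > 0" using assms that by (cases q) auto
    then show ?thesis by (auto simp: abs_le_iff field_simps)
  qed
  then show ?thesis by (auto simp: shifted_fracs_def shifted_frac_def)
qed

text \<open>Each \<open>q\<close> in \<open>A\<close> contributes the integers of an interval of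
  length \<open>2 * q * h\<close>, where \<open>Q \<le> q < 2 * Q\<close>. The lower bound retains
  \<open>card A\<close>, through which the share of the block enters.\<close>

lemma
  assumes A: "A \<subseteq> {Q..<2*Q}" and h: "0 \<le> h"
  shows finite_shifted_fracs: "finite (shifted_fracs \<sigma> A z h)"
    and card_shifted_fracs_le: "real (card (shifted_fracs \<sigma> A z h)) \<le> real Q * (4 * real Q * h + 1)"
    and card_shifted_fracs_ge: "real (card A) * (2 * real Q * h - 1) \<le> real (card (shifted_fracs \<sigma> A z h))"
proof -
  let ?F = "\<lambda>q. {a::int. real q * (z - h) - \<sigma> \<le> of_int a \<and> of_int a \<le> real q * (z + h) - \<sigma>}"
  have fA: "finite A" using A finite_subset by blast
  have cA: "card A \<le> Q" using card_mono [OF _ A] by simp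
  have A0: "0 \<notin> A" using A by auto
  have len: "real q * (z + h) - \<sigma> - (real q * (z - h) - \<sigma>) = 2 * real q * h" for q
    by (simp add: algebra_simps)
  show "finite (shifted_fracs \<sigma> A z h)"
    unfolding shifted_fracs_eq_Sigma [OF A0] using fA finite_int_between by (intro finite_SigmaI) auto
  have eq: "real (card (shifted_fracs \<sigma> A z h)) = (\<Sum>q\<in>A. real (card (?F q)))"
    unfolding shifted_fracs_eq_Sigma [OF A0] using fA finite_int_between by (subst card_SigmaI) auto
  have "real (card (?F q)) \<le> 4 * real Q * h + 1" if "q \<in> A" for q
  proof -
    have "real q * (z - h) - \<sigma> \<le> real q * (z + h) - \<sigma> + 1"
      using h len[of q] mult_nonneg_nonneg[of "real q" h] by linarith
    then have "real (card (?F q)) \<le> 2 * real q * h + 1"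
      using card_int_between_le len[of q] by metis
    also have "2 * real q * h \<le> 2 * (2 * real Q) * h"
      using that A h by (intro mult_right_mono) auto
    finally show ?thesis by simp
  qed
  then have "real (card (shifted_fracs \<sigma> A z h)) \<le> real (card A) * (4 * real Q * h + 1)"
    unfolding eq by (rule sum_bounded_above)
  also have "\<dots> \<le> real Q * (4 * real Q * h + 1)"
    using cA h by (intro mult_right_mono) auto
  finally show "real (card (shifted_fracs \<sigma> A z h)) \<le> real Q * (4 * real Q * h + 1)" .
  have "2 * real Q * h - 1 \<le> real (card (?F q))" if "q \<in> A" for q
  proof -
    have "2 * real Q * h \<le> 2 * real q * h"
      using that A h by (intro mult_right_mono) auto
    then show ?thesis
      using card_int_between_ge[of "real q * (z + h) - \<sigma>" "real q * (z - h) - \<sigma>"] len[of q] by linarith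
  qed
  then show "real (card A) * (2 * real Q * h - 1) \<le> real (card (shifted_fracs \<sigma> A z h))"
    unfolding eq by (rule sum_bounded_below)
qed

section \<open>Clusters and resonant fractions\<close>

text \<open>
  Among more than \<open>M\<close> denominators in \<open>{Q..<2*Q}\<close> two differ by at most \<open>Q / M\<close>, and the
  difference of the two corresponding lattice points, made primitive, is a witness for resonance.
\<close>

lemma card_cluster_le:
  assumes fin: "finite C" and M: "M \<ge> 1"
    and C: "\<And>p. p \<in> C \<Longrightarrow> fst p \<in> {Q..<2*Q} \<and> \<not> resonant \<sigma> M Q p"
    and near: "\<And>p p'. p \<in> C \<Longrightarrow> p' \<in> C \<Longrightarrow> \<bar>shifted_frac \<sigma> p - shifted_frac \<sigma> p'\<bar> \<le> 1 / (8 * (real Q)\<^sup>2)"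
  shows "card C \<le> M"
proof (rule ccontr)
  assume big: "\<not> card C \<le> M"
  then have "C \<noteq> {}" by auto
  then obtain p0 where "p0 \<in> C" by blast
  then have Q: "Q > 0" using C[of p0] by auto
  \<comment> \<open>This is the determinant of \<open>(q, a + \<sigma>)\<close> and
    \<open>(q', a' + \<sigma>)\<close>: it equals \<open>q * q'\<close> times the gap of the two
    fractions, hence is below \<open>(2 * Q)\<^sup>2 / (8 * Q\<^sup>2)\<close>.\<close>
  have det: "\<bar>real (fst p) * (of_int (snd p') + \<sigma>) - real (fst p') * (of_int (snd p) + \<sigma>)\<bar> < 1/2"
    if p: "p \<in> C" "p' \<in> C" for p p'
  proof -
    have pos: "real (fst p) > 0" "real (fst p') > 0" using C[OF p(1)] C[OF p(2)] Q by auto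
    have "real (fst p) * (of_int (snd p') + \<sigma>) - real (fst p') * (of_int (snd p) + \<sigma>)
        = (real (fst p) * real (fst p')) * (shifted_frac \<sigma> p' - shifted_frac \<sigma> p)"
      using pos by (simp add: shifted_frac_def field_simps)
    then have "\<bar>real (fst p) * (of_int (snd p') + \<sigma>) - real (fst p') * (of_int (snd p) + \<sigma>)\<bar>
        = (real (fst p) * real (fst p')) * \<bar>shifted_frac \<sigma> p' - shifted_frac \<sigma> p\<bar>"
      using pos by (simp add: abs_mult)
    also have "\<dots> \<le> (real (fst p) * real (fst p')) * (1 / (8 * (real Q)\<^sup>2))"
      using near[OF p(2,1)] pos by (intro mult_left_mono) auto
    also have "\<dots> < ((2 * real Q) * (2 * real Q)) * (1 / (8 * (real Q)\<^sup>2))"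
      using C[OF p(1)] C[OF p(2)] Q pos
      by (intro mult_strict_right_mono mult_strict_mono) auto
    also have "\<dots> = 1/2" using Q by (simp add: power2_eq_square)
    finally show ?thesis .
  qed
  \<comment> \<open>For equal denominators the determinant is a positive integer times an integer,
    so the latter vanishes.\<close>
  have inj: "inj_on fst C"
  proof (rule inj_onI)
    fix p p' assume p: "p \<in> C" "p' \<in> C" "fst p = fst p'"
    have "real (fst p) \<ge> 1" using C[OF p(1)] Q by auto
    have "real (fst p) * \<bar>of_int (snd p' - snd p)\<bar>
        = \<bar>real (fst p) * (of_int (snd p') + \<sigma>) - real (fst p') * (of_int (snd p) + \<sigma>)\<bar>"
    proof -
      have "real (fst p) * \<bar>of_int (snd p' - snd p)\<bar> = \<bar>real (fst p) * of_int (snd p' - snd p)\<bar>"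
        by (simp add: abs_mult)
      also have "real (fst p) * of_int (snd p' - snd p)
          = real (fst p) * (of_int (snd p') + \<sigma>) - real (fst p') * (of_int (snd p) + \<sigma>)"
        using p(3) by (simp add: algebra_simps)
      finally show ?thesis .
    qed
    also have "\<dots> < 1/2" by (rule det[OF p(1,2)])
    finally have "real (fst p) * \<bar>of_int (snd p' - snd p)\<bar> < 1/2" .
    moreover have "1 * \<bar>of_int (snd p' - snd p)\<bar> \<le> real (fst p) * \<bar>of_int (snd p' - snd p)\<bar>"
      using \<open>real (fst p) \<ge> 1\<close> by (intro mult_right_mono) auto
    ultimately have "\<bar>real_of_int (snd p' - snd p)\<bar> < 1/2" by (metis mult_1 le_less_trans)
    then have "snd p = snd p'" by linarith
    with p show "p = p'" by (simp add: prod_eq_iff)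
  qed
  \<comment> \<open>\<open>f\<close> sorts the denominators into \<open>M\<close> bins of length
    \<open>Q / M\<close>.\<close>
  define f where "f = (\<lambda>p::nat\<times>int. (fst p - Q) * M div Q)"
  have "f p < M" if "p \<in> C" for p
  proof -
    have "(fst p - Q) * M < M * Q" using C[OF that] M Q by (simp add: mult.commute less_diff_conv2)
    then show ?thesis unfolding f_def by (simp add: less_mult_imp_div_less)
  qed
  then have "f ` C \<subseteq> {..<M}" by auto
  then have "card (f ` C) \<le> M" by (metis card_lessThan card_mono finite_lessThan)
  then have "\<not> inj_on f C" using big by (intro pigeonhole) auto
  then obtain p p' where p: "p \<in> C" "p' \<in> C" "f p = f p'" "p \<noteq> p'" by (auto simp: inj_on_def)
  then have "fst p \<noteq> fst p'" using inj by (auto simp: inj_on_def)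
  then obtain p1 p2 where p12: "p1 \<in> C" "p2 \<in> C" "f p1 = f p2" "fst p1 < fst p2"
    using p by (metis linorder_neq_iff)
  define u0 where "u0 = fst p2 - fst p1"
  define w0 where "w0 = snd p2 - snd p1"
  have u0: "u0 \<ge> 1" "int u0 = int (fst p2) - int (fst p1)" using p12 by (auto simp: u0_def)
  have u0M: "u0 * M \<le> Q"
  proof -
    let ?a = "(fst p1 - Q) * M" and ?b = "(fst p2 - Q) * M"
    have "?b = ?a + u0 * M"
      using p12 C[of p1] by (simp add: u0_def flip: add_mult_distrib)
    moreover have "?b < Q * (?a div Q) + Q" "Q * (?a div Q) \<le> ?a"
      using p12(3) Q unfolding f_def
      by (metis add.commute div_mult_mod_eq mod_less_divisor mult.commute nat_add_left_cancel_less)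
        (simp add: mult.commute)
    ultimately show ?thesis by linarith
  qed
  \<comment> \<open>Dividing the difference vector by \<open>g \<ge> 1\<close> makes it primitive
    and shrinks the determinant by the factor \<open>g\<close>, so the bound \<open>1/2\<close>
    survives.\<close>
  define g where "g = gcd (int u0) w0"
  have g: "g \<ge> 1" using u0 by (simp add: g_def int_one_le_iff_zero_less)
  obtain u' w where uw: "int u0 = u' * g" "w0 = w * g" "coprime u' w"
    using gcd_coprime_exists[of "int u0" w0] u0 unfolding g_def by (metis gcd_eq_0_iff g g_def not_one_le_zero)
  have "u' > 0" using uw(1) u0 g by (metis of_nat_0_less_iff zero_less_mult_pos2 less_le_trans zero_less_one)
  then obtain u where u: "u' = int u" "u \<ge> 1" by (metis pos_int_cases Suc_leI One_nat_def)
  have "int u \<le> int u0" using uw(1) u g mult_left_mono[of 1 g "int u"] by simp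
  then have "u * M \<le> Q" using u0M by (meson mult_le_mono1 of_nat_le_iff order_trans)
  moreover have "\<bar>real (fst p1) * of_int w - of_int (snd p1) * real u - \<sigma> * real u\<bar> < 1/2"
  proof -
    let ?D = "real (fst p1) * of_int w - of_int (snd p1) * real u - \<sigma> * real u"
    have ru: "real u0 = real u * of_int g" using uw(1) u by (metis of_int_mult of_int_of_nat_eq)
    have rw: "of_int w0 = of_int w * (of_int g :: real)" using uw(2) by simp
    have ru0: "real u0 = real (fst p2) - real (fst p1)" using p12 by (simp add: u0_def)
    have "of_int g * ?D = real (fst p1) * of_int w0 - (of_int (snd p1) + \<sigma>) * real u0"
      unfolding ru rw by (simp add: algebra_simps)
    also have "\<dots> = real (fst p1) * (of_int (snd p2) + \<sigma>) - real (fst p2) * (of_int (snd p1) + \<sigma>)"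
      unfolding ru0 w0_def by (simp add: algebra_simps)
    finally have "\<bar>of_int g * ?D\<bar> < 1/2" using det[OF p12(1,2)] by simp
    moreover have "1 * \<bar>?D\<bar> \<le> of_int g * \<bar>?D\<bar>" using g by (intro mult_right_mono) auto
    ultimately show ?thesis using g by (simp add: abs_mult)
  qed
  ultimately have "resonant \<sigma> M Q p1"
    unfolding resonant_def using u uw(3) by blast
  then show False using C p12 by blast
qed

text \<open>The integer \<open>q * w - a * u\<close> is within \<open>1/2\<close> of
  \<open>\<sigma> * u\<close>, hence the same for all points of \<open>S\<close>. By coprimality the
  denominators agree modulo \<open>u\<close>, and they determine the points, so \<open>u\<close>
  consecutive denominators carry at most one.\<close>

lemma card_line_le:
  fixes \<sigma> :: real
  assumes u: "1 \<le> u" and cop: "coprime (int u) w" and Q: "Q \<ge> 1"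
  defines "S \<equiv> {p. fst p \<in> {Q..<2*Q} \<and> \<bar>real (fst p) * of_int w - of_int (snd p) * real u - \<sigma> * real u\<bar> < 1/2}"
  shows "finite S" "card S \<le> Q div u + 1"
proof -
  define f where "f = (\<lambda>p::nat\<times>int. (fst p - Q) div u)"
  have inj: "inj_on f S"
  proof (rule inj_onI)
    fix p p' assume p: "p \<in> S" "p' \<in> S" "f p = f p'"
    define n n' where "n = int (fst p) * w - snd p * int u" and "n' = int (fst p') * w - snd p' * int u"
    have "\<bar>of_int n - \<sigma> * real u\<bar> < 1/2" "\<bar>of_int n' - \<sigma> * real u\<bar> < 1/2"
      using p by (auto simp: S_def n_def n'_def)
    then have "n = n'" by linarith
    then have e: "(int (fst p) - int (fst p')) * w = (snd p - snd p') * int u"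
      by (simp add: n_def n'_def algebra_simps)
    then have "int u dvd (int (fst p) - int (fst p')) * w" by simp
    then have "int u dvd int (fst p) - int (fst p')"
      using cop coprime_dvd_mult_left_iff by blast
    moreover have "int (fst p) - int (fst p') = int (fst p - Q) - int (fst p' - Q)"
      using p by (auto simp: S_def)
    ultimately have "(fst p - Q) mod u = (fst p' - Q) mod u"
      by (metis mod_eq_dvd_iff of_nat_eq_iff of_nat_mod)
    with p(3) have "fst p - Q = fst p' - Q"
      unfolding f_def by (metis div_mult_mod_eq)
    then have 1: "fst p = fst p'" using p by (auto simp: S_def)
    with e u have "snd p = snd p'" by simp
    with 1 show "p = p'" by (simp add: prod_eq_iff)
  qed
  have sub: "f ` S \<subseteq> {..Q div u}"
  proof -
    have "(fst p - Q) div u \<le> Q div u" if "p \<in> S" for p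
      using that by (intro div_le_mono) (auto simp: S_def)
    then show ?thesis by (auto simp: f_def)
  qed
  show "finite S" using finite_imageD[OF finite_subset[OF sub] inj] by simp
  have "card S = card (f ` S)" using inj by (simp add: card_image)
  also have "\<dots> \<le> card {..Q div u}" using sub by (intro card_mono) auto
  finally show "card S \<le> Q div u + 1" by simp
qed

text \<open>Sum over the short primitive vectors: for given \<open>u\<close> at most
  \<open>2 * h * u + 2\<close> values \<open>w\<close> are possible, and each line carries at most
  \<open>2 * Q / u\<close> points. The products add up to a main term with the saving
  \<open>1 / M\<close> and a harmonic sum of lower order.\<close>

lemma card_resonant_le:
  assumes Q: "Q \<ge> 1" and M: "M \<ge> 1" and h: "0 \<le> h"
  shows "real (card {p \<in> shifted_fracs \<sigma> {Q..<2*Q} z h. resonant \<sigma> M Q p})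
    \<le> 4 * h * (real Q)\<^sup>2 / real M + 4 * real Q * harm Q"
proof -
  define S where "S = (\<lambda>u w. {p. fst p \<in> {Q..<2*Q} \<and>
     \<bar>real (fst p) * of_int w - of_int (snd p) * real u - \<sigma> * real u\<bar> < 1/2})"
  \<comment> \<open>The candidates \<open>w\<close>: those within \<open>1/2\<close> of
    \<open>u * x\<close> for some \<open>x\<close> at distance at most \<open>h\<close> from
    \<open>z\<close>.\<close>
  define V where "V = (\<lambda>u::nat. {w::int. (real u * (z - h) - 1/2 \<le> of_int w \<and>
      of_int w \<le> real u * (z + h) + 1/2) \<and> coprime (int u) w})"
  define N where "N = Q div M"
  have finV: "finite (V u)" for u
    unfolding V_def by (rule finite_subset[OF _ finite_int_between[of "real u * (z - h) - 1/2" "real u * (z + h) + 1/2"]]) auto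
  have cardV: "real (card (V u)) \<le> 2 * h * real u + 2" for u
  proof -
    let ?V = "{w::int. real u * (z - h) - 1/2 \<le> of_int w \<and> of_int w \<le> real u * (z + h) + 1/2}"
    have "card (V u) \<le> card ?V"
      by (intro card_mono finite_int_between) (auto simp: V_def)
    also have "real (card ?V) \<le> (real u * (z + h) + 1/2) - (real u * (z - h) - 1/2) + 1"
      using h mult_nonneg_nonneg[of "real u" h] by (intro card_int_between_le) (auto simp: algebra_simps)
    also have "\<dots> = 2 * h * real u + 2" by (simp add: algebra_simps)
    finally show ?thesis by simp
  qed
  have sub: "{p \<in> shifted_fracs \<sigma> {Q..<2*Q} z h. resonant \<sigma> M Q p} \<subseteq> (\<Union>u\<in>{1..N}. \<Union>w\<in>V u. S u w)"
  proof
    fix p assume "p \<in> {p \<in> shifted_fracs \<sigma> {Q..<2*Q} z h. resonant \<sigma> M Q p}"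
    then have p: "fst p \<in> {Q..<2*Q}" "\<bar>shifted_frac \<sigma> p - z\<bar> \<le> h" and "resonant \<sigma> M Q p" by (auto simp: shifted_fracs_def)
    then obtain u w where uw: "1 \<le> u" "u * M \<le> Q" "coprime (int u) w"
      "\<bar>real (fst p) * of_int w - of_int (snd p) * real u - \<sigma> * real u\<bar> < 1/2"
      by (auto simp: resonant_def)
    have "u \<in> {1..N}" using uw M by (auto simp: N_def less_eq_div_iff_mult_less_eq)
    have q: "real (fst p) \<ge> 1" using p Q by auto
    have "real (fst p) * (of_int w - real u * shifted_frac \<sigma> p) = real (fst p) * of_int w - of_int (snd p) * real u - \<sigma> * real u"
      using q by (simp add: shifted_frac_def field_simps)
    then have "real (fst p) * \<bar>of_int w - real u * shifted_frac \<sigma> p\<bar> < 1/2"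
      using uw(4) q by (metis abs_mult abs_of_nat)
    moreover have "1 * \<bar>of_int w - real u * shifted_frac \<sigma> p\<bar> \<le> real (fst p) * \<bar>of_int w - real u * shifted_frac \<sigma> p\<bar>"
      using q by (intro mult_right_mono) auto
    ultimately have 1: "\<bar>of_int w - real u * shifted_frac \<sigma> p\<bar> < 1/2" by (metis mult_1 le_less_trans)
    have "\<bar>real u * shifted_frac \<sigma> p - real u * z\<bar> \<le> real u * h"
      using p(2) by (metis abs_mult abs_of_nat mult_left_mono of_nat_0_le_iff right_diff_distrib)
    with 1 have "w \<in> V u"
      using uw(3) unfolding V_def mem_Collect_eq right_diff_distrib distrib_left by linarith
    moreover have "p \<in> S u w" using uw p by (simp add: S_def)
    ultimately show "p \<in> (\<Union>u\<in>{1..N}. \<Union>w\<in>V u. S u w)" using \<open>u \<in> {1..N}\<close> by blast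
  qed
  have finS: "finite (S u w)" and cardS: "real (card (S u w)) \<le> 2 * real Q / real u"
    if "u \<in> {1..N}" "w \<in> V u" for u w
  proof -
    have u: "1 \<le> u" "u \<le> Q" using that Q M by (auto simp: N_def intro: order_trans[OF _ div_le_dividend])
    have cop: "coprime (int u) w" using that by (simp add: V_def)
    show "finite (S u w)" unfolding S_def by (rule card_line_le(1)[OF u(1) cop Q])
    have "real (card (S u w)) \<le> real (Q div u) + 1"
      unfolding S_def using card_line_le(2)[OF u(1) cop Q, of \<sigma>] by linarith
    also have "\<dots> \<le> real Q / real u + 1" by (simp add: of_nat_div_le_of_nat)
    also have "\<dots> \<le> real Q / real u + real Q / real u" using u by (simp add: field_simps)
    also have "\<dots> = 2 * real Q / real u" by simp
    finally show "real (card (S u w)) \<le> 2 * real Q / real u" .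
  qed
  have "real (card {p \<in> shifted_fracs \<sigma> {Q..<2*Q} z h. resonant \<sigma> M Q p}) \<le> real (card (\<Union>u\<in>{1..N}. \<Union>w\<in>V u. S u w))"
    using finV finS by (intro of_nat_mono card_mono sub) auto
  also have "\<dots> \<le> real (\<Sum>u\<in>{1..N}. card (\<Union>w\<in>V u. S u w))"
    by (intro of_nat_mono card_UN_le) auto
  also have "\<dots> \<le> (\<Sum>u\<in>{1..N}. (2 * h * real u + 2) * (2 * real Q / real u))"
    unfolding of_nat_sum
  proof (rule sum_mono)
    fix u assume u: "u \<in> {1..N}"
    have "real (card (\<Union>w\<in>V u. S u w)) \<le> (\<Sum>w\<in>V u. real (card (S u w)))"
      unfolding of_nat_sum[symmetric] by (intro of_nat_mono card_UN_le finV)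
    also have "\<dots> \<le> real (card (V u)) * (2 * real Q / real u)"
      using cardS[OF u] by (rule sum_bounded_above)
    also have "\<dots> \<le> (2 * h * real u + 2) * (2 * real Q / real u)"
      using cardV by (intro mult_right_mono) auto
    finally show "real (card (\<Union>w\<in>V u. S u w)) \<le> (2 * h * real u + 2) * (2 * real Q / real u)" .
  qed
  also have "\<dots> = (\<Sum>u\<in>{1..N}. 4 * h * real Q + 4 * real Q * inverse (real u))"
    by (intro sum.cong refl) (auto simp: field_simps)
  also have "\<dots> = 4 * h * real Q * real N + 4 * real Q * harm N"
    by (simp add: sum.distrib harm_def flip: sum_distrib_left)
  also have "4 * h * real Q * real N \<le> 4 * h * real Q * (real Q / real M)"
    using h by (intro mult_left_mono) (auto simp: N_def of_nat_div_le_of_nat)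
  also have "4 * real Q * harm N \<le> 4 * real Q * harm Q"
    by (intro mult_left_mono harm_mono) (auto simp: N_def)
  finally show ?thesis by (simp add: power2_eq_square)
qed

section \<open>Separation of nonresonant fractions and overlaps of balls\<close>

text \<open>The window of length \<open>2 * R\<close> is cut into at most
  \<open>16 * R * Q\<^sup>2 + 1\<close> cells of length \<open>1 / (8 * Q\<^sup>2)\<close>;
  \<open>card_cluster_le\<close> bounds each cell.\<close>

lemma card_near_le:
  assumes fin: "finite G" and M: "M \<ge> 1" and Q: "Q \<ge> 1" and R: "R \<ge> 0"
    and G: "\<And>p. p \<in> G \<Longrightarrow> fst p \<in> {Q..<2*Q} \<and> \<not> resonant \<sigma> M Q p"
  shows "real (card {p\<in>G. \<bar>shifted_frac \<sigma> p - y\<bar> < R}) \<le> real M * (16 * R * (real Q)\<^sup>2 + 1)"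
proof -
  define D where "D = {p\<in>G. \<bar>shifted_frac \<sigma> p - y\<bar> < R}"
  define f where "f = (\<lambda>p. \<lfloor>(shifted_frac \<sigma> p - y + R) * (8 * (real Q)\<^sup>2)\<rfloor>)"
  let ?I = "{0..\<lfloor>16 * R * (real Q)\<^sup>2\<rfloor>}"
  have finD: "finite D" using fin by (simp add: D_def)
  have fI: "f p \<in> ?I" if "p \<in> D" for p
  proof -
    have "0 \<le> shifted_frac \<sigma> p - y + R" "shifted_frac \<sigma> p - y + R \<le> 2 * R" using that by (auto simp: D_def)
    then have "0 \<le> (shifted_frac \<sigma> p - y + R) * (8 * (real Q)\<^sup>2)"
      "(shifted_frac \<sigma> p - y + R) * (8 * (real Q)\<^sup>2) \<le> 2 * R * (8 * (real Q)\<^sup>2)"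
      by (simp, intro mult_right_mono) auto
    then show ?thesis unfolding f_def by (auto simp: floor_mono)
  qed
  have fib: "card {p\<in>D. f p = k} \<le> M" for k
  proof (rule card_cluster_le)
    show "finite {p\<in>D. f p = k}" using finD by simp
    show "fst p \<in> {Q..<2*Q} \<and> \<not> resonant \<sigma> M Q p" if "p \<in> {p\<in>D. f p = k}" for p
      using that G by (auto simp: D_def)
    fix p p' assume "p \<in> {p\<in>D. f p = k}" "p' \<in> {p\<in>D. f p = k}"
    then have "f p = f p'" by simp
    then have "\<bar>(shifted_frac \<sigma> p - y + R) * (8 * (real Q)\<^sup>2) - (shifted_frac \<sigma> p' - y + R) * (8 * (real Q)\<^sup>2)\<bar> \<le> 1"
      unfolding f_def by linarith
    also have "(shifted_frac \<sigma> p - y + R) * (8 * (real Q)\<^sup>2) - (shifted_frac \<sigma> p' - y + R) * (8 * (real Q)\<^sup>2)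
      = (shifted_frac \<sigma> p - shifted_frac \<sigma> p') * (8 * (real Q)\<^sup>2)" by (simp add: algebra_simps)
    finally have "\<bar>shifted_frac \<sigma> p - shifted_frac \<sigma> p'\<bar> * (8 * (real Q)\<^sup>2) \<le> 1" by (simp add: abs_mult)
    then show "\<bar>shifted_frac \<sigma> p - shifted_frac \<sigma> p'\<bar> \<le> 1 / (8 * (real Q)\<^sup>2)"
      using Q by (simp add: pos_le_divide_eq)
  qed (use M in auto)
  have "D \<subseteq> (\<Union>k\<in>?I. {p\<in>D. f p = k})" using fI by blast
  then have "card D \<le> card (\<Union>k\<in>?I. {p\<in>D. f p = k})"
    using finD by (intro card_mono) auto
  also have "\<dots> \<le> (\<Sum>k\<in>?I. card {p\<in>D. f p = k})" by (intro card_UN_le) auto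
  also have "\<dots> \<le> of_nat (card ?I) * M" by (intro sum_bounded_above fib)
  finally have "real (card D) \<le> real (card ?I) * real M" by (metis of_nat_id of_nat_le_iff of_nat_mult)
  also have "\<dots> \<le> (16 * R * (real Q)\<^sup>2 + 1) * real M"
  proof (rule mult_right_mono)
    have "0 \<le> 16 * R * (real Q)\<^sup>2" using R by simp
    then have "real (card ?I) = of_int \<lfloor>16 * R * (real Q)\<^sup>2\<rfloor> + 1" by simp
    then show "real (card ?I) \<le> 16 * R * (real Q)\<^sup>2 + 1" by linarith
  qed simp
  finally show ?thesis by (simp add: D_def mult.commute)
qed

lemma measure_ball_real: "r \<ge> 0 \<Longrightarrow> measure lebesgue (ball (x::real) r) = 2 * r"
  by (simp add: ball_eq_greaterThanLessThan)

text \<open>Only centres closer than \<open>\<rho> + \<rho>'\<close> to \<open>y\<close> contribute,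
  each at most \<open>2 * \<rho>'\<close>. The part
  \<open>32 * M * \<rho> * \<rho>' * Q\<^sup>2\<close> is what independence predicts up to a
  constant; the rest is an error term.\<close>

lemma sum_measure_ball_inter_le:
  assumes fin: "finite G" and M: "M \<ge> 1" and Q: "Q \<ge> 1" and \<rho>: "\<rho> \<ge> 0" "\<rho>' \<ge> 0"
    and G: "\<And>p. p \<in> G \<Longrightarrow> fst p \<in> {Q..<2*Q} \<and> \<not> resonant \<sigma> M Q p"
  shows "(\<Sum>p\<in>G. measure lebesgue (ball y \<rho> \<inter> ball (shifted_frac \<sigma> p) \<rho>'))
    \<le> 2 * \<rho>' * (real M * (16 * (\<rho> + \<rho>') * (real Q)\<^sup>2 + 1))"
proof -
  have "measure lebesgue (ball y \<rho> \<inter> ball (shifted_frac \<sigma> p) \<rho>')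
      \<le> (if \<bar>shifted_frac \<sigma> p - y\<bar> < \<rho> + \<rho>' then 2 * \<rho>' else 0)" for p
  proof (cases "\<bar>shifted_frac \<sigma> p - y\<bar> < \<rho> + \<rho>'")
    case True
    have "measure lebesgue (ball y \<rho> \<inter> ball (shifted_frac \<sigma> p) \<rho>') \<le> measure lebesgue (ball (shifted_frac \<sigma> p) \<rho>')"
      by (intro measure_mono_fmeasurable) auto
    also have "\<dots> = 2 * \<rho>'" by (rule measure_ball_real[OF \<rho>(2)])
    finally show ?thesis using True by simp
  next
    case False
    then have "ball y \<rho> \<inter> ball (shifted_frac \<sigma> p) \<rho>' = {}" by (auto simp: dist_real_def)
    then show ?thesis using False by simp
  qed
  then have "(\<Sum>p\<in>G. measure lebesgue (ball y \<rho> \<inter> ball (shifted_frac \<sigma> p) \<rho>'))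
      \<le> (\<Sum>p\<in>G. if \<bar>shifted_frac \<sigma> p - y\<bar> < \<rho> + \<rho>' then 2 * \<rho>' else 0)"
    by (intro sum_mono)
  also have "\<dots> = 2 * \<rho>' * real (card {p\<in>G. \<bar>shifted_frac \<sigma> p - y\<bar> < \<rho> + \<rho>'})"
    using fin by (simp add: sum.If_cases Int_def mult.commute)
  also have "\<dots> \<le> 2 * \<rho>' * (real M * (16 * (\<rho> + \<rho>') * (real Q)\<^sup>2 + 1))"
    using \<rho> by (intro mult_left_mono card_near_le fin M Q G) auto
  finally show ?thesis .
qed

text \<open>\<open>A\<close> supplies at least \<open>2 * h * Q\<^sup>2 / l - Q\<close> fractions.
  With \<open>M = 4 * l\<close> the whole block has at most \<open>h * Q\<^sup>2 / l\<close>
  resonant ones up to a harmonic term, and by \<open>large\<close> the lower order terms consume at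
  most half of the difference.\<close>

lemma card_nonresonant_ge:
  assumes A: "A \<subseteq> {Q..<2*Q}" and Q: "Q \<ge> 1" and l: "l \<ge> 1" and dense: "Q \<le> l * card A"
    and h: "h \<ge> 0" and large: "1 + 4 * harm Q \<le> h * real Q / (2 * real l)"
  shows "h * (real Q)\<^sup>2 / (2 * real l)
    \<le> real (card {p \<in> shifted_fracs \<sigma> A z h. \<not> resonant \<sigma> (4*l) Q p})"
proof -
  let ?P = "shifted_fracs \<sigma> A z h" and ?R = "{p \<in> shifted_fracs \<sigma> {Q..<2*Q} z h. resonant \<sigma> (4*l) Q p}"
  have finP: "finite ?P" using A h by (rule finite_shifted_fracs)
  moreover have "finite (shifted_fracs \<sigma> {Q..<2*Q} z h)" using finite_shifted_fracs[OF subset_refl h] .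
  moreover have "?P \<subseteq> shifted_fracs \<sigma> {Q..<2*Q} z h" using A by (auto simp: shifted_fracs_def)
  ultimately have "card ?P \<le> card ({p \<in> ?P. \<not> resonant \<sigma> (4*l) Q p} \<union> ?R)"
    by (intro card_mono) auto
  also have "\<dots> \<le> card {p \<in> ?P. \<not> resonant \<sigma> (4*l) Q p} + card ?R"
    by (rule card_Un_le)
  finally have 1: "real (card ?P) \<le> real (card {p \<in> ?P. \<not> resonant \<sigma> (4*l) Q p}) + real (card ?R)"
    by linarith
  have "real (card ?R) \<le> 4 * h * (real Q)\<^sup>2 / real (4*l) + 4 * real Q * harm Q"
    using Q l h by (intro card_resonant_le) auto
  then have 2: "real (card ?R) \<le> h * (real Q)\<^sup>2 / real l + 4 * real Q * harm Q"
    by simp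
  have 3: "real (card A) * (2 * real Q * h - 1) \<le> real (card ?P)"
    using A h by (rule card_shifted_fracs_ge)
  have "card A \<le> Q" using card_mono [OF _ A] by simp
  then have 4: "real (card A) \<le> real Q" by simp
  have "real Q \<le> real l * real (card A)" using dense by (metis of_nat_le_iff of_nat_mult)
  then have "real Q / real l \<le> real (card A)" using l by (simp add: field_simps)
  then have "real Q / real l * (2 * real Q * h) \<le> real (card A) * (2 * real Q * h)"
    using h by (intro mult_right_mono) auto
  then have 5: "2 * (h * (real Q)\<^sup>2 / real l) \<le> real (card A) * (2 * real Q * h)"
    by (simp add: power2_eq_square mult_ac)
  have "real Q * (1 + 4 * harm Q) \<le> real Q * (h * real Q / (2 * real l))"
    using large by (intro mult_left_mono) auto
  then have 6: "real Q + 4 * real Q * harm Q \<le> h * (real Q)\<^sup>2 / (2 * real l)"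
    by (simp add: power2_eq_square algebra_simps)
  \<comment> \<open>Here \<open>p\<close>, \<open>s\<close>, \<open>r\<close> are the total,
    nonresonant and resonant counts, \<open>y\<close> is the claimed bound, \<open>H\<close> the
    harmonic term, \<open>e\<close> the main term, \<open>a = card A\<close> and
    \<open>q = Q\<close>.\<close>
  have arith: "y \<le> s" if "p \<le> s + r" "r \<le> 2 * y + H" "e - a \<le> p" "a \<le> q" "2 * (2 * y) \<le> e" "q + H \<le> y"
    for y s p r H e a q :: real using that by linarith
  have half: "h * (real Q)\<^sup>2 / real l = 2 * (h * (real Q)\<^sup>2 / (2 * real l))" by simp
  show ?thesis
    by (rule arith[OF 1 2[unfolded half] 3[unfolded right_diff_distrib mult_1_right] 4 5[unfolded half] 6])
qed

section \<open>Growth and divergence of series\<close>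

lemma harm_le_1_plus_ln: "n \<ge> 1 \<Longrightarrow> harm n \<le> 1 + ln (real n)"
  using decseqD[OF decseq_harm_diff_ln, of 0 "n - 1"] by (simp add: harm_expand)

text \<open>Provides \<open>large\<close> of \<open>card_nonresonant_ge\<close> for late blocks:
  \<open>harm (2^j)\<close> grows only linearly in \<open>j\<close>.\<close>

lemma eventually_harm_le:
  fixes c :: real
  assumes "c > 0"
  shows "eventually (\<lambda>j::nat. 1 + 4 * harm (2^j) \<le> c * 2^j) sequentially"
proof -
  have "eventually (\<lambda>j::nat. 5 + 4 * (real j * ln 2) \<le> c * 2^j) sequentially"
    using assms by real_asymp
  then show ?thesis
  proof eventually_elim
    case (elim j)
    have "harm (2^j) \<le> 1 + real j * ln 2"
      using harm_le_1_plus_ln[of "2^j"] by (simp add: ln_realpow)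
    with elim show ?case by linarith
  qed
qed

lemma sum_ge_1_if_not_summable:
  fixes t :: "nat \<Rightarrow> real"
  assumes "\<And>n. t n \<ge> 0" "\<not> summable t"
  obtains N where "sum t {n..<N} \<ge> 1"
proof -
  have "\<not> summable (\<lambda>i. t (i + n))" using assms by simp
  then have "\<not> (\<forall>N. (\<Sum>i<N. t (i + n)) \<le> 1)"
    using summableI_nonneg_bounded[of "\<lambda>i. t (i + n)" 1] assms(1) by blast
  then obtain N where "(\<Sum>i<N. t (i + n)) > 1" by (meson not_le)
  also have "(\<Sum>i<N. t (i + n)) = sum t {n..<N+n}"
    using sum.shift_bounds_nat_ivl[of t 0 n N] by (simp add: atLeast0LessThan)
  finally show ?thesis by (intro that[of "N + n"]) simp
qed

lemma sum_power_div_le: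
  "(\<Sum>i\<in>{i\<in>{n..<N}. i \<le> j}. 4^i / 4^j) \<le> (2::real)"
proof -
  have "(\<Sum>i\<in>{i\<in>{n..<N}. i \<le> j}. 4^i / 4^j) \<le> (\<Sum>i<Suc j. 4^i / (4::real)^j)"
    by (intro sum_mono2) auto
  also have "\<dots> = (\<Sum>i<Suc j. 4^i) / 4^j" by (simp only: sum_divide_distrib)
  also have "\<dots> \<le> 2" by (simp add: geometric_sum field_simps)
  finally show ?thesis .
qed

section \<open>Balls from late blocks\<close>

text \<open>\<open>chung_erdos\<close> for nonresonant balls near \<open>z\<close>. A late block
  with \<open>t j > 0\<close> has, up to factors depending on \<open>l\<close>,
  \<open>h * 4^j\<close> such fractions, so its balls have total length about
  \<open>h * t j\<close>. The share of the interval obtained depends on \<open>l\<close>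
  alone.\<close>

lemma limsup_balls_locally_large:
  fixes t :: "nat \<Rightarrow> real" and l :: nat
  assumes l: "l \<ge> 1" and A: "\<And>j. A j \<subseteq> {2^j..<2*2^j}"
    and t: "\<And>j. 0 \<le> t j" "\<And>j. t j \<le> 1" "\<not> summable t"
    and dense: "\<And>j. t j > 0 \<Longrightarrow> 2^j \<le> l * card (A j)"
    and h: "h > 0"
  obtains X where "finite X"
    "\<forall>(j,p)\<in>X. n \<le> j \<and> fst p \<in> A j \<and> \<bar>shifted_frac \<sigma> p - z\<bar> \<le> h \<and> t j / 4^j \<le> h"
    "h / (3360 * real l ^ 3) \<le> measure lebesgue (\<Union>(j,p)\<in>X. ball (shifted_frac \<sigma> p) (t j / 4^j))"
proof -
  define P where "P = (\<lambda>j. {p \<in> shifted_fracs \<sigma> (A j) z h. \<not> resonant \<sigma> (4*l) (2^j) p})"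
  define \<rho> where "\<rho> = (\<lambda>j. t j / 4^j)"
  have \<rho>0: "\<rho> j \<ge> 0" for j using t by (simp add: \<rho>_def)
  have "h / (2 * real l) > 0" using h l by simp
  then have "eventually (\<lambda>j::nat. 1 + 4 * harm (2^j) \<le> h / (2 * real l) * 2^j) sequentially"
    by (rule eventually_harm_le)
  then obtain n0 where n0: "\<And>j. j \<ge> n0 \<Longrightarrow> 1 + 4 * harm (2^j) \<le> h / (2 * real l) * 2^j"
    unfolding eventually_sequentially by blast
  define n1 where "n1 = max n n0"
  \<comment> \<open>Total weight at least \<open>1\<close> gives \<open>s \<le> s\<^sup>2\<close>,
    which later absorbs the error terms linear in \<open>s\<close>.\<close>
  obtain N where N: "sum t {n1..<N} \<ge> 1" using sum_ge_1_if_not_summable t(1,3) by blast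
  define J where "J = {n1..<N}"
  define s where "s = sum t J"
  have s: "s \<ge> 1" using N by (simp add: s_def J_def)
  have finJ: "finite J" by (simp add: J_def)
  have large: "1 + 4 * harm (2^j) \<le> h * real (2^j) / (2 * real l)" if "j \<in> J" for j
    using n0[of j] that by (simp add: J_def n1_def)
  have hQ: "1 \<le> h * 2^j" if "j \<in> J" for j
  proof -
    have "1 \<le> h * 2^j / (2 * real l)"
      using large[OF that] harm_nonneg[of "2^j", where 'a=real] by simp
    also have "\<dots> \<le> h * 2^j / 1" using l h by (intro divide_left_mono) auto
    finally show ?thesis by simp
  qed
  have \<rho>h: "\<rho> j \<le> h" if "j \<in> J" for j
  proof -
    have "\<rho> j \<le> 1 / 4^j" using t by (simp add: \<rho>_def divide_right_mono)
    also have "\<dots> \<le> 1 / 2^j" by (intro divide_left_mono power_mono) auto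
    also have "\<dots> \<le> h" using hQ[OF that] by (simp add: field_simps)
    finally show ?thesis .
  qed
  have four: "(real (2^j))\<^sup>2 = 4^j" for j by (simp add: power2_eq_square flip: power_mult_distrib)
  have finP: "finite (P j)" for j
    unfolding P_def using finite_shifted_fracs[OF A, of h] h by simp
  have Pup: "real (card (P j)) \<le> 5 * h * 4^j" if "j \<in> J" for j
  proof -
    have "real (card (P j)) \<le> real (card (shifted_fracs \<sigma> (A j) z h))"
      unfolding P_def using finite_shifted_fracs[OF A, of h] h by (intro of_nat_mono card_mono) auto
    also have "\<dots> \<le> 2^j * (4 * 2^j * h + 1)"
      using card_shifted_fracs_le[OF A, of h] h by simp
    also have "\<dots> \<le> 2^j * (4 * 2^j * h + h * 2^j)"
      using hQ[OF that] by (intro mult_left_mono) auto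
    also have "\<dots> = 5 * h * (real (2^j))\<^sup>2" by (simp add: power2_eq_square algebra_simps)
    finally show ?thesis unfolding four .
  qed
  have Plow: "t j * (h / (2 * real l)) \<le> \<rho> j * real (card (P j))" if "j \<in> J" for j
  proof (cases "t j = 0")
    case True then show ?thesis by (simp add: \<rho>_def)
  next
    case False
    then have "t j > 0" using t(1)[of j] by simp
    have "h * (real (2^j))\<^sup>2 / (2 * real l) \<le> real (card (P j))"
      unfolding P_def using h
      by (intro card_nonresonant_ge A l dense \<open>t j > 0\<close> large that) auto
    then have "\<rho> j * (h * 4^j / (2 * real l)) \<le> \<rho> j * real (card (P j))"
      unfolding four using \<rho>0 by (intro mult_left_mono) auto
    then show ?thesis by (simp add: \<rho>_def)
  qed
  define X where "X = Sigma J P"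
  define B where "B = (\<lambda>(j,p). ball (shifted_frac \<sigma> p) (\<rho> j))"
  have finX: "finite X" unfolding X_def using finJ finP by blast
  have sum_X: "sum F X = (\<Sum>i\<in>J. \<Sum>p\<in>P i. F (i,p))" for F :: "_ \<Rightarrow> real"
    unfolding X_def using finJ finP by (simp add: sum.Sigma split_def)
  define T where "T = (\<lambda>i j. \<Sum>p\<in>P i. \<Sum>p'\<in>P j.
      measure lebesgue (ball (shifted_frac \<sigma> p) (\<rho> i) \<inter> ball (shifted_frac \<sigma> p') (\<rho> j)))"
  have T_sym: "T i j = T j i" for i j
    unfolding T_def by (subst sum.swap) (simp add: Int_commute)
  \<comment> \<open>\<open>640 = 5 * 2 * 4 * 16\<close> and \<open>680 = 5 * 2 * 4 * 17\<close>: the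
    \<open>5\<close> comes from \<open>Pup\<close>, the \<open>2\<close> from the ball length, the
    \<open>4\<close> from \<open>M = 4 * l\<close>, and \<open>17\<close> bounds
    \<open>16 * \<rho> j * 4^j + 1\<close>.\<close>
  define c1 c2 where "c1 = 640 * h * real l" and "c2 = 680 * h * real l"
  have c0: "c1 \<ge> 0" "c2 \<ge> 0" using h by (auto simp: c1_def c2_def)
  \<comment> \<open>Each ball of the earlier block \<open>i\<close> is tested against all of the
    later block \<open>j\<close>; in this order the error carries \<open>4^i / 4^j\<close>, which is
    summable over \<open>i \<le> j\<close>.\<close>
  have T_le: "T i j \<le> c1 * (t i * t j) + c2 * (t j * (4^i / 4^j))" if ij: "i \<le> j" "i \<in> J" "j \<in> J" for i j
  proof -
    let ?b = "2 * \<rho> j * (real (4*l) * (16 * (\<rho> i + \<rho> j) * (real (2^j))\<^sup>2 + 1))"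
    have "(\<Sum>p'\<in>P j. measure lebesgue (ball (shifted_frac \<sigma> p) (\<rho> i) \<inter> ball (shifted_frac \<sigma> p') (\<rho> j))) \<le> ?b" for p
    proof (rule sum_measure_ball_inter_le)
      show "fst p \<in> {2^j..<2*2^j} \<and> \<not> resonant \<sigma> (4*l) (2^j) p" if "p \<in> P j" for p
        using that A[of j] by (auto simp: P_def shifted_fracs_def)
    qed (use l finP \<rho>0 in auto)
    then have "T i j \<le> real (card (P i)) * ?b"
      unfolding T_def by (intro sum_bounded_above)
    also have "\<dots> \<le> 5 * h * 4^i * ?b"
      using Pup[OF ij(2)] \<rho>0 by (intro mult_right_mono) auto
    also have "\<dots> \<le> 5 * h * 4^i * (2 * \<rho> j * (real (4*l) * (16 * \<rho> i * 4^j + 17)))"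
    proof -
      have "\<rho> j * 4^j \<le> 1" using t by (simp add: \<rho>_def)
      then show ?thesis
        unfolding four using h \<rho>0 by (intro mult_left_mono) (auto simp: algebra_simps)
    qed
    also have "\<dots> = c1 * (t i * t j) + c2 * (t j * (4^i / 4^j))"
      by (simp add: \<rho>_def c1_def c2_def field_simps)
    finally show ?thesis .
  qed
  \<comment> \<open>The error term, set to \<open>0\<close> for \<open>i > j\<close>, so that
    \<open>g i j + g j i\<close> serves both orders of a pair.\<close>
  define g where "g = (\<lambda>i j. if i \<le> j then t j * (4^i / 4^j) else 0)"
  have T_le': "T i j \<le> c1 * (t i * t j) + c2 * (g i j + g j i)" if "i \<in> J" "j \<in> J" for i j
  proof -
    have g0: "g i j \<ge> 0" "g j i \<ge> 0" using t by (auto simp: g_def)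
    show ?thesis
    proof (cases "i \<le> j")
      case True
      then have "T i j \<le> c1 * (t i * t j) + c2 * g i j" using T_le[OF True that] by (simp add: g_def)
      also have "c2 * g i j \<le> c2 * (g i j + g j i)" using g0 c0 by (intro mult_left_mono) auto
      finally show ?thesis by simp
    next
      case False
      then have "j \<le> i" by simp
      then have "T i j \<le> c1 * (t i * t j) + c2 * g j i"
        using T_le[OF \<open>j \<le> i\<close> that(2,1)] by (simp add: g_def T_sym mult.commute)
      also have "c2 * g j i \<le> c2 * (g i j + g j i)" using g0 c0 by (intro mult_left_mono) auto
      finally show ?thesis by simp
    qed
  qed
  have gsum: "(\<Sum>j\<in>J. \<Sum>i\<in>J. g i j) \<le> 2 * s"
  proof -
    have "(\<Sum>i\<in>J. g i j) \<le> t j * 2" for j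
    proof -
      have "(\<Sum>i\<in>J. g i j) = t j * (\<Sum>i\<in>{i\<in>J. i \<le> j}. 4^i / 4^j)"
        using finJ unfolding g_def sum_distrib_left by (rule sum.inter_filter [symmetric])
      also have "\<dots> \<le> t j * 2"
        unfolding J_def by (intro mult_left_mono sum_power_div_le t)
      finally show ?thesis .
    qed
    then have "(\<Sum>j\<in>J. \<Sum>i\<in>J. g i j) \<le> (\<Sum>j\<in>J. t j * 2)" by (intro sum_mono)
    then show ?thesis by (simp add: s_def sum_distrib_right mult.commute)
  qed
  have "(\<Sum>x\<in>X. \<Sum>y\<in>X. measure lebesgue (B x \<inter> B y)) = (\<Sum>i\<in>J. \<Sum>j\<in>J. T i j)"
  proof -
    have "(\<Sum>x\<in>X. \<Sum>y\<in>X. measure lebesgue (B x \<inter> B y))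
       = (\<Sum>i\<in>J. \<Sum>p\<in>P i. \<Sum>j\<in>J. \<Sum>p'\<in>P j. measure lebesgue (B (i,p) \<inter> B (j,p')))"
      by (simp only: sum_X)
    also have "\<dots> = (\<Sum>i\<in>J. \<Sum>j\<in>J. T i j)"
      unfolding T_def B_def by (intro sum.cong refl, subst sum.swap) simp
    finally show ?thesis .
  qed
  also have "\<dots> \<le> (\<Sum>i\<in>J. \<Sum>j\<in>J. c1 * (t i * t j) + c2 * (g i j + g j i))"
    by (intro sum_mono T_le')
  also have "\<dots> = c1 * s\<^sup>2 + c2 * ((\<Sum>i\<in>J. \<Sum>j\<in>J. g i j) + (\<Sum>i\<in>J. \<Sum>j\<in>J. g j i))"
  proof -
    have "c1 * s\<^sup>2 = (\<Sum>i\<in>J. \<Sum>j\<in>J. c1 * (t i * t j))"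
      unfolding s_def power2_eq_square sum_product by (simp only: sum_distrib_left)
    then show ?thesis by (simp only: sum.distrib distrib_left sum_distrib_left)
  qed
  also have "(\<Sum>i\<in>J. \<Sum>j\<in>J. g i j) = (\<Sum>j\<in>J. \<Sum>i\<in>J. g i j)" by (rule sum.swap)
  also have "c1 * s\<^sup>2 + c2 * ((\<Sum>j\<in>J. \<Sum>i\<in>J. g i j) + (\<Sum>i\<in>J. \<Sum>j\<in>J. g j i)) \<le> c1 * s\<^sup>2 + c2 * (2 * s + 2 * s)"
    using gsum c0 by (intro add_mono mult_left_mono order_refl) auto
  also have "\<dots> \<le> c1 * s\<^sup>2 + c2 * (4 * s\<^sup>2)"
    using s c0 by (intro add_mono mult_left_mono order_refl) (auto simp: power2_eq_square)
  \<comment> \<open>\<open>3360 = 640 + 4 * 680\<close>.\<close>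
  also have "\<dots> = 3360 * h * real l * s\<^sup>2" by (simp add: c1_def c2_def)
  finally have second: "(\<Sum>x\<in>X. \<Sum>y\<in>X. measure lebesgue (B x \<inter> B y)) \<le> 3360 * h * real l * s\<^sup>2" .
  have "h / real l * s = (\<Sum>j\<in>J. 2 * (t j * (h / (2 * real l))))"
    by (simp add: s_def sum_divide_distrib sum_distrib_left mult.commute)
  also have "\<dots> \<le> (\<Sum>j\<in>J. 2 * (\<rho> j * real (card (P j))))"
    using Plow by (intro sum_mono mult_left_mono) auto
  also have "\<dots> = (\<Sum>x\<in>X. measure lebesgue (B x))"
    by (simp add: sum_X B_def measure_ball_real \<rho>0 mult_ac del: measure_completion)
  finally have first: "h / real l * s \<le> (\<Sum>x\<in>X. measure lebesgue (B x))" .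
  let ?m = "measure lebesgue (\<Union>x\<in>X. B x)"
  have "(h / real l * s)\<^sup>2 \<le> (\<Sum>x\<in>X. measure lebesgue (B x))\<^sup>2"
    using first h s by (intro power_mono) auto
  also have "\<dots> \<le> ?m * (\<Sum>x\<in>X. \<Sum>y\<in>X. measure lebesgue (B x \<inter> B y))"
    by (intro chung_erdos finX) (auto simp: B_def split: prod.splits)
  also have "\<dots> \<le> ?m * (3360 * h * real l * s\<^sup>2)"
    using second by (intro mult_left_mono) auto
  also have "(h / real l * s)\<^sup>2 = h / (3360 * real l ^ 3) * (3360 * h * real l * s\<^sup>2)"
    using l by (simp add: power2_eq_square power3_eq_cube)
  finally have "h / (3360 * real l ^ 3) \<le> ?m"
    by (rule mult_right_le_imp_le) (use h s l in auto)
  then have "h / (3360 * real l ^ 3) \<le> measure lebesgue (\<Union>(j,p)\<in>X. ball (shifted_frac \<sigma> p) (t j / 4^j))"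
    by (simp add: B_def \<rho>_def)
  moreover have "\<forall>(j,p)\<in>X. n \<le> j \<and> fst p \<in> A j \<and> \<bar>shifted_frac \<sigma> p - z\<bar> \<le> h \<and> t j / 4^j \<le> h"
    using \<rho>h by (auto simp: X_def J_def n1_def P_def shifted_fracs_def \<rho>_def)
  ultimately show ?thesis by (intro that[of X] finX)
qed

text \<open>Late balls fill a fixed share of every \<open>ball z r\<close> with
  \<open>r < 1\<close>, so the uncovered set satisfies the density criterion.\<close>

lemma limsup_balls_full:
  fixes t :: "nat \<Rightarrow> real" and l :: nat
  assumes l: "l \<ge> 1" and A: "\<And>j. A j \<subseteq> {2^j..<2*2^j}"
    and t: "\<And>j. 0 \<le> t j" "\<And>j. t j \<le> 1" "\<not> summable t"
    and dense: "\<And>j. t j > 0 \<Longrightarrow> 2^j \<le> l * card (A j)"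
  shows "negligible ({0..1} - (\<Union>j\<in>{n..}. \<Union>p\<in>{p. fst p \<in> A j}. ball (shifted_frac \<sigma> p) (t j / 4^j)))"
    (is "negligible ({0..1} - ?V)")
proof (rule negligible_if_uniformly_not_dense)
  have "open ?V" by auto
  then show S: "{0..1} - ?V \<in> lmeasurable"
    by (intro fmeasurable_Diff) (auto simp: borel_open)
  \<comment> \<open>\<open>13440 = 4 * 3360\<close>: for \<open>h = r / 2\<close> the local lower
    bound is \<open>d * (2 * r)\<close>, and \<open>2 * r\<close> is the length of
    \<open>ball z r\<close>. This \<open>h\<close> also keeps the balls inside
    \<open>ball z r\<close>.\<close>
  define d where "d = 1 / (13440 * real l ^ 3)"
  have "real l ^ 3 \<ge> 1" using l by simp
  then have "1 \<le> 13440 * real l ^ 3" by linarith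
  then have d: "0 < d" "d \<le> 1" using l by (auto simp: d_def divide_le_eq)
  then show "0 \<le> 1 - d" "1 - d < 1" by auto
  fix z r :: real assume r: "0 < r" "r < 1"
  have "r/2 > 0" using r by simp
  then obtain X where X: "finite X"
    "\<forall>(j,p)\<in>X. n \<le> j \<and> fst p \<in> A j \<and> \<bar>shifted_frac \<sigma> p - z\<bar> \<le> r/2 \<and> t j / 4^j \<le> r/2"
    "(r/2) / (3360 * real l ^ 3) \<le> measure lebesgue (\<Union>(j,p)\<in>X. ball (shifted_frac \<sigma> p) (t j / 4^j))"
    using limsup_balls_locally_large[OF l A t dense, where h="r/2" and n=n and \<sigma>=\<sigma> and z=z] by blast
  let ?U = "\<Union>(j,p)\<in>X. ball (shifted_frac \<sigma> p) (t j / 4^j)"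
  have Uz: "?U \<subseteq> ball z r"
  proof
    fix y assume "y \<in> ?U"
    then obtain j p where "(j,p) \<in> X" "\<bar>shifted_frac \<sigma> p - y\<bar> < t j / 4^j" by (auto simp: dist_real_def)
    moreover from this X(2) have "\<bar>shifted_frac \<sigma> p - z\<bar> \<le> r/2" "t j / 4^j \<le> r/2" by blast+
    ultimately show "y \<in> ball z r" unfolding mem_ball dist_real_def by linarith
  qed
  have UV: "?U \<subseteq> ?V" using X(2) by fastforce
  have Um: "?U \<in> lmeasurable" using X(1) by (intro fmeasurable.finite_UN) auto
  have "emeasure lebesgue (({0..1} - ?V) \<inter> ball z r) \<le> emeasure lebesgue (ball z r - ?U)"
    using UV Um by (intro emeasure_mono) auto
  also have "\<dots> = ennreal (measure lebesgue (ball z r - ?U))"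
    using Um by (intro emeasure_eq_measure2 fmeasurable.Diff) auto
  also have "measure lebesgue (ball z r - ?U) = 2 * r - measure lebesgue ?U"
    using measurable_measure_Diff[OF _ fmeasurableD[OF Um] Uz] measure_ball_real[of r z] r by simp
  also have "\<dots> \<le> (1 - d) * (2 * r)"
    using X(3) by (simp add: d_def algebra_simps)
  also have "ennreal ((1 - d) * (2 * r)) = ennreal (1 - d) * emeasure lebesgue (ball z r)"
    using d r measure_ball_real[of r z] by (simp add: ennreal_mult emeasure_eq_measure2)
  finally show "emeasure lebesgue (({0..1} - ?V) \<inter> ball z r) \<le> ennreal (1 - d) * emeasure lebesgue (ball z r)"
    by (simp add: ennreal_leI)
qed

section \<open>Dyadic weights and the final deduction\<close>

lemma not_summable_min_1:
  fixes f :: "nat \<Rightarrow> real"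
  assumes "\<not> summable f"
  shows "\<not> summable (\<lambda>n. min 1 (f n))"
proof
  assume s: "summable (\<lambda>n. min 1 (f n))"
  then have "(\<lambda>n. min 1 (f n)) \<longlonglongrightarrow> 0" by (rule summable_LIMSEQ_zero)
  then have "eventually (\<lambda>n. min 1 (f n) < 1) sequentially" by (rule order_tendstoD) simp
  then have "eventually (\<lambda>n. min 1 (f n) = f n) sequentially" by eventually_elim auto
  from summable_cong[OF this] s assms show False by simp
qed

text \<open>Cauchy condensation. The endpoint \<open>2 * 2^j\<close> is used because
  \<open>\<psi>\<close> is there at most its value anywhere in the block; the factor
  \<open>1/2\<close> compensates for denominators up to \<open>2 * 2^j\<close>.\<close>

lemma not_summable_dyadic:
  fixes \<psi> :: "nat \<Rightarrow> real"
  assumes nonneg: "\<And>q. q \<ge> 1 \<Longrightarrow> \<psi> q \<ge> 0"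
    and dec: "\<And>q. q \<ge> 1 \<Longrightarrow> \<psi> (q + 1) \<le> \<psi> q"
    and div: "filterlim (\<lambda>N. \<Sum>q=1..N. \<psi> q) at_top sequentially"
  shows "\<not> summable (\<lambda>j. 2^j * \<psi> (2 * 2^j) / 2)"
proof
  assume s: "summable (\<lambda>j. 2^j * \<psi> (2 * 2^j) / 2)"
  \<comment> \<open>\<open>\<psi> 0\<close> may be negative, whereas condensation and the bound by
    \<open>suminf f\<close> take non-negative terms.\<close>
  define f where "f = (\<lambda>q. if q = 0 then 0 else \<psi> q)"
  \<comment> \<open>The factor \<open>4\<close> turns the term at \<open>j\<close> into the
    condensed term at \<open>Suc j\<close>.\<close>
  have "summable (\<lambda>j. 4 * (2^j * \<psi> (2 * 2^j) / 2))" using s by (rule summable_mult)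
  moreover have "(\<lambda>j. 4 * (2^j * \<psi> (2 * 2^j) / 2)) = (\<lambda>j. 2^Suc j * f (2^Suc j))"
    by (simp add: f_def fun_eq_iff)
  ultimately have "summable (\<lambda>j. 2^Suc j * f (2^Suc j))" by metis
  then have "summable (\<lambda>j. 2^j * f (2^j))" by (subst (asm) summable_Suc_iff)
  then have sf: "summable f"
    using dec nonneg by (subst condensation_test) (auto simp: f_def)
  have "(\<Sum>q=1..N. \<psi> q) \<le> suminf f" for N
  proof -
    have "(\<Sum>q=1..N. \<psi> q) = sum f {1..N}" by (intro sum.cong) (auto simp: f_def)
    also have "\<dots> \<le> suminf f" using sf nonneg by (intro sum_le_suminf) (auto simp: f_def)
    finally show ?thesis .
  qed
  moreover obtain N where "(\<Sum>q=1..N. \<psi> q) > suminf f"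
    using eventually_happens[OF filterlim_at_top_dense[THEN iffD1, OF div, rule_format, of "suminf f"]] by auto
  ultimately show False by (meson not_le)
qed

theorem theorem3:
  fixes l :: nat and \<pi> :: "nat \<Rightarrow> nat set" and \<sigma> :: "nat \<Rightarrow> real" and \<psi> :: "nat \<Rightarrow> real"
  assumes "l \<ge> 1"
    and "inj_on \<pi> {1..l}"
    and "partition_on {1..} (\<pi> ` {1..l})"
    and "\<And>q. q \<ge> 1 \<Longrightarrow> \<psi> q \<ge> 0"
    and "\<And>q. q \<ge> 1 \<Longrightarrow> \<psi> (q + 1) \<le> \<psi> q"
    and "filterlim (\<lambda>N. \<Sum>q=1..N. \<psi> q) at_top sequentially"
  shows "\<exists>k\<in>{1..l}. emeasure lebesgue (W (\<lambda>q. indicator (\<pi> k) q * \<psi> q) (\<sigma> k)) = 1"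
proof -
  have cover: "{1..} = (\<Union>k\<in>{1..l}. \<pi> k)"
    using assms(3) by (auto simp: partition_on_def)
  have mono: "\<psi> q \<le> \<psi> p" if "1 \<le> p" "p \<le> q" for p q
    using that(2)
  proof (induction q rule: dec_induct)
    case (step n)
    then show ?case using assms(5)[of n] that(1) by simp
  qed simp
  define D :: "nat \<Rightarrow> nat set" where "D = (\<lambda>j. {2^j..<2*2^j})"
  \<comment> \<open>Pigeonhole: \<open>l\<close> classes cover the \<open>2^j\<close> elements of
    the block.\<close>
  have "\<exists>k\<in>{1..l}. 2^j \<le> l * card (\<pi> k \<inter> D j)" for j
  proof (rule ccontr)
    assume "\<not> ?thesis"
    then have less: "l * card (\<pi> k \<inter> D j) < 2^j" if "k \<in> {1..l}" for k using that by force
    have "x \<ge> 1" if "x \<in> D j" for x using that by (auto simp: D_def Suc_le_eq intro: less_le_trans)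
    then have "D j \<subseteq> (\<Union>k\<in>{1..l}. \<pi> k)" unfolding cover[symmetric] by auto
    then have "D j = (\<Union>k\<in>{1..l}. \<pi> k \<inter> D j)" by blast
    then have "card (D j) \<le> (\<Sum>k\<in>{1..l}. card (\<pi> k \<inter> D j))"
      by (metis card_UN_le finite_atLeastAtMost)
    then have "l * 2^j \<le> (\<Sum>k\<in>{1..l}. l * card (\<pi> k \<inter> D j))"
      by (simp add: D_def flip: sum_distrib_left)
    also have "\<dots> < (\<Sum>k\<in>{1..l}. 2^j)"
      using less assms(1) by (intro sum_strict_mono) auto
    finally show False by simp
  qed
  then obtain \<kappa> where \<kappa>: "\<And>j. \<kappa> j \<in> {1..l}" "\<And>j. 2^j \<le> l * card (\<pi> (\<kappa> j) \<inter> D j)"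
    by metis
  \<comment> \<open>With radius \<open>\<tau> j / 4^j\<close>, a denominator
    \<open>q < 2 * 2^j\<close> gives an error below \<open>\<psi> (2 * 2^j) \<le> \<psi> q\<close>.
    The cap at \<open>1\<close> is required by the overlap bounds.\<close>
  define \<tau> where "\<tau> = (\<lambda>j::nat. min 1 (2^j * \<psi> (2 * 2^j) / 2))"
  have \<tau>: "0 \<le> \<tau> j" "\<tau> j \<le> 1" for j using assms(4)[of "2 * 2^j"] by (auto simp: \<tau>_def)
  have "\<not> summable \<tau>"
    unfolding \<tau>_def using assms(4-6) by (intro not_summable_min_1 not_summable_dyadic)
  \<comment> \<open>Each block passes its weight to the class \<open>\<kappa> j\<close> that is
    dense in it; elsewhere weight \<open>0\<close> makes the balls empty and the density condition
    vacuous. The \<open>t k\<close> add up to \<open>\<tau>\<close>, so one of them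
    diverges.\<close>
  define t where "t = (\<lambda>k j. if \<kappa> j = k then \<tau> j else 0)"
  have "\<exists>k\<in>{1..l}. \<not> summable (t k)"
  proof (rule ccontr)
    assume "\<not> ?thesis"
    then have "summable (\<lambda>j. \<Sum>k\<in>{1..l}. t k j)" by (intro summable_sum) auto
    moreover have "(\<Sum>k\<in>{1..l}. t k j) = \<tau> j" for j using \<kappa>(1)[of j] by (simp add: t_def)
    ultimately show False using \<open>\<not> summable \<tau>\<close> by simp
  qed
  then obtain k where k: "k \<in> {1..l}" "\<not> summable (t k)" by blast
  define V where "V = (\<lambda>n::nat. \<Union>j\<in>{n..}. \<Union>p\<in>{p. fst p \<in> \<pi> k \<inter> D j}. ball (shifted_frac (\<sigma> k) p) (t k j / 4^j))"
  have V: "negligible ({0..1} - V n)" for n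
    unfolding V_def
  proof (rule limsup_balls_full[OF assms(1)])
    show "2^j \<le> l * card (\<pi> k \<inter> D j)" if "t k j > 0" for j
      using that \<kappa>(2)[of j] by (auto simp: t_def split: if_splits)
  qed (use \<tau> k in \<open>auto simp: t_def D_def\<close>)
  let ?W = "W (\<lambda>q. indicator (\<pi> k) q * \<psi> q) (\<sigma> k)"
  \<comment> \<open>A point of every \<open>V n\<close> lies in balls from arbitrarily late blocks,
    and denominators in block \<open>j\<close> exceed \<open>j\<close>, so infinitely many of them
    occur.\<close>
  have sub: "{0..1} - ?W \<subseteq> (\<Union>n. {0..1} - V n)"
  proof (rule ccontr)
    assume "\<not> ?thesis"
    then obtain \<alpha> where \<alpha>: "\<alpha> \<in> {0..1}" "\<alpha> \<notin> ?W" "\<And>n. \<alpha> \<in> V n" by blast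
    let ?I = "{q \<in> {1..}. nearest_int_dist (real q * \<alpha> - \<sigma> k) < indicator (\<pi> k) q * \<psi> q}"
    have "\<exists>q\<ge>n. q \<in> ?I" for n
    proof -
      obtain j p where jp: "j \<ge> n" "fst p \<in> \<pi> k" "fst p \<in> D j" "\<bar>shifted_frac (\<sigma> k) p - \<alpha>\<bar> < t k j / 4^j"
        using \<alpha>(3)[of n] by (auto simp: V_def dist_real_def)
      define q a where "q = fst p" and "a = snd p"
      have q: "2^j \<le> q" "q < 2 * 2^j" using jp by (auto simp: D_def q_def)
      have "j < 2^j" by simp
      then have q1: "n \<le> q" "1 \<le> q" using q(1) jp(1) by linarith+
      have "nearest_int_dist (real q * \<alpha> - \<sigma> k) \<le> \<bar>real q * \<alpha> - \<sigma> k - of_int a\<bar>"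
        unfolding nearest_int_dist_def by (rule round_diff_minimal)
      also have "real q * \<alpha> - \<sigma> k - of_int a = real q * (\<alpha> - shifted_frac (\<sigma> k) p)"
        using q1 by (simp add: shifted_frac_def q_def a_def field_simps)
      also have "\<bar>\<dots>\<bar> = real q * \<bar>shifted_frac (\<sigma> k) p - \<alpha>\<bar>" by (simp add: abs_mult abs_minus_commute)
      also have "\<dots> < real q * (t k j / 4^j)" using jp q1 by (intro mult_strict_left_mono) auto
      also have "\<dots> \<le> (2 * 2^j) * (t k j / 4^j)"
      proof (rule mult_right_mono)
        have "real q < real (2 * 2^j)" using q(2) by (simp only: of_nat_less_iff)
        then show "real q \<le> 2 * 2^j" by simp
        show "0 \<le> t k j / 4^j" using \<tau> by (simp add: t_def)
      qed
      also have "\<dots> \<le> (2 * 2^j) * ((2^j * \<psi> (2 * 2^j) / 2) / 4^j)"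
        using assms(4)[of "2 * 2^j"] by (intro mult_left_mono divide_right_mono) (auto simp: t_def \<tau>_def)
      also have "\<dots> = \<psi> (2 * 2^j)" by (simp add: field_simps flip: power_mult_distrib)
      also have "\<dots> \<le> \<psi> q" using q q1 by (intro mono) auto
      also have "\<dots> = indicator (\<pi> k) q * \<psi> q" using jp by (simp add: q_def)
      finally show ?thesis using q1 by auto
    qed
    then have "infinite ?I" unfolding infinite_nat_iff_unbounded_le by blast
    then have "\<alpha> \<in> ?W" using \<alpha>(1) by (simp add: W_def)
    with \<alpha>(2) show False by blast
  qed
  have "negligible (\<Union>n. {0..1} - V n)" using V by (intro negligible_countable_Union) auto
  \<comment> \<open>Completeness of Lebesgue measure makes this subset null, so \<open>?W\<close>,
    as its complement in the unit interval, is also measurable.\<close>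
  then have "{0..1} - ?W \<in> null_sets lebesgue"
    using sub negligible_subset negligible_iff_null_sets by blast
  then have "emeasure lebesgue ({0..1} - ({0..1} - ?W)) = emeasure lebesgue {0..1::real}"
    by (intro emeasure_Diff_null_set) auto
  moreover have "{0..1} - ({0..1} - ?W) = ?W" by (auto simp: W_def)
  ultimately show ?thesis using k(1) by auto
qed

end
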